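(* Consider the gas-generator coupled generalized Riemann problem for two one-dimensional compressible Euler flows, with the notation and standing assumptions of the context. It reduces to the linear system $$ \begin{aligned} &h_L X + k_L Z = q_L,\\ &h_R Y + k_R Z = q_R,\\ &\Bigl(1-\frac{\mathcal E}{\bar\rho_*^2}\frac{\bar g_u}{\bar g_\rho}\Bigr)X - Y-\frac{\mathcal E}{\bar\rho_*^2}\frac{\bar g_p}{\bar g_\rho}\,Z=\frac{\mathcal E'}{\bar\rho_*}-\frac{\mathcal E}{\bar\rho_*^2}\frac{\bar f}{\bar g_\rho} \end{aligned} $$ for the unknowns $(X,Y,Z)=\bigl((\partial_t\bar u)_*,(\partial_t u)_*,(\partial_t\bar p)_*\bigr)\in\mathbb R^3$. This system has a unique solution if the left-going 1-wave of the associated coupled Riemann problem is a rarefaction wave or a weak shock, regardless of the type (rarefaction or shock) of the right-going 3-wave. Precisely: (i) if the 1-wave is a rarefaction wave, the system has exactly one solution; (ii) for every left state $(\bar\rho_L,\bar u_L,\bar p_L)$ and every value $\mathcal E\ge 0$ there exists $\varepsilon>0$ such that, whenever the 1-wave is a shock with $|(\bar\rho_*,\bar u_*,\bar p_* )-(\bar\rho_L,\bar u_L,\bar p_L)|<\varepsilon$, the system has exactly one solution.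
   Context: **Equations and coupling.** On $x<0$ (quantities with an over-bar) and on $x>0$ (quantities without a bar) the gas is governed by the Euler equations $\rho_t+(\rho u)_x=0$, $(\rho u)_t+(\rho u^2+p)_x=0$, together with conservation of energy, for an ideal gas $p=(\gamma-1)\rho e$ with constant $\gamma>1$, $\rho,p>0$, and sound speed $c=\sqrt{\gamma p/\rho}$. At the interface $x=0$ the coupling conditions are $$\bar p=p,\qquad \bar\rho=\rho,\qquad \bar u=u+\mathcal E(t)/\bar\rho ,$$ with a given differentiable outtake function $\mathcal E(t)\ge0$. Below, $\mathcal E$ and $\mathcal E'$ denote the values of this function and of its derivative at the initial time $t_0$. The flow at the interface is assumed subsonic and directed to the right: $0\le\bar u<\bar c$ and $0\le u<c$ at $x=0^\mp$. **Associated coupled Riemann problem.** Let the left state $(\bar\rho_L,\bar u_L,\bar p_L)$ and the right state $(\rho_R,u_R,p_R)$ be the limits of the initial data at $x=0^\mp$. The associated coupled Riemann problem is assumed to have a solution of the following form. - A left-going 1-wave, lying in $x<0$, connects $(\bar\rho_L,\bar u_L,\bar p_L)$ to $(\bar\rho_*,\bar u_*,\bar p_* )$, the state at $x=0^-$. - The state at $x=0^+$ is $(\bar\rho_*,u_*,p_* )$ with $p_*=\bar p_*$ and $\bar u_*=u_*+\mathcal E/\bar\rho_*$. - A contact discontinuity of speed $u_*$ connects this to $(\rho_{*R},u_*,p_* )$. - A right-going 3-wave, lying in $x>0$, connects $(\rho_{*R},u_*,p_* )$ to $(\rho_R,u_R,p_R)$. Put $\bar c_*=\sqrt{\gamma\bar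 p_*/\bar\rho_*}$ and $c_{*R}=\sqrt{\gamma p_*/\rho_{*R}}$. The subsonic and direction assumptions read $0\le\bar u_*<\bar c_*$ and $0\le u_*<\bar c_*$. **Wave curves.** Let $\mu^2=(\gamma-1)/(\gamma+1)$ and $$\Phi(p;\hat p,\hat\rho)=(p-\hat p)\sqrt{\frac{1-\mu^2}{\hat\rho\,(p+\mu^2\hat p)}},\qquad H(p;\hat p,\hat\rho)=\hat\rho\,\frac{p+\mu^2\hat p}{\hat p+\mu^2p}.$$ - The 1-wave is a shock if $\bar p_*>\bar p_L$. Then $\bar u_*=\bar u_L-\Phi(\bar p_*;\bar p_L,\bar\rho_L)$, $\bar\rho_*=H(\bar p_*;\bar p_L,\bar\rho_L)$, and the shock speed is $\sigma_L=\dfrac{\bar\rho_*\bar u_*-\bar\rho_L\bar u_L}{\bar\rho_*-\bar\rho_L}<0$. - The 1-wave is a rarefaction if $\bar p_*\le\bar p_L$. Then $p\rho^{-\gamma}$ and $u+\frac{2c}{\gamma-1}$ take the same values at the left state and at $(\bar\rho_*,\bar u_*,\bar p_* )$. - The 3-wave is a shock if $p_*>p_R$. Then $u_*=u_R+\Phi(p_*;p_R,\rho_R)$, $\rho_{*R}=H(p_*;p_R,\rho_R)$, and the shock speed is $\sigma_R=\dfrac{\rho_{*R}u_*-\rho_Ru_R}{\rho_{*R}-\rho_R}>0$. - The 3-wave is a rarefaction if $p_*\le p_R$. Then $p\rho^{-\gamma}$ and $u-\frac{2c}{\gamma-1}$ take the same values at $(\rho_{*R},u_*,p_* )$ and at the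 right state. **Coefficients $a,b$.** Write $\Phi_1=\partial\Phi/\partial p$ and $H_1=\partial H/\partial p$, both evaluated at $(\bar p_*;\bar p_L,\bar\rho_L)$ for the left wave and at $(p_*;p_R,\rho_R)$ for the right wave. - 1-rarefaction: $a_L=1$, $b_L=\dfrac1{\bar\rho_*\bar c_*}$. - 1-shock: $a_L=1-\bar\rho_*(\sigma_L-\bar u_* )\Phi_1$, $b_L=-\dfrac{\sigma_L-\bar u_*}{\bar\rho_*\bar c_*^2}+\Phi_1$. - 3-rarefaction: $a_R=1$, $b_R=-\dfrac1{\rho_{*R}c_{*R}}$. - 3-shock: $a_R=1+\rho_{*R}(\sigma_R-u_* )\Phi_1$, $b_R=-\dfrac{\sigma_R-u_*}{\rho_{*R}c_{*R}^2}-\Phi_1$. **Coefficients $h,k,q$.** $$h_L=a_L-\bar\rho_*\bar u_*b_L,\quad k_L=b_L-\frac{\bar u_*}{\bar\rho_*\bar c_*^2}a_L,\quad q_L=\Bigl(1-\frac{\bar u_*^2}{\bar c_*^2}\Bigr)d_L,$$ $$h_R=a_R-\rho_{*R}u_*b_R,\quad k_R=b_R-\frac{u_*}{\rho_{*R}c_{*R}^2}a_R,\quad q_R=\Bigl(1-\frac{u_*^2}{c_{*R}^2}\Bigr)d_R.$$ **Coefficients $\bar g$.** They come from the density relation $\bar g_\rho(\partial_t\bar\rho)_*+\bar g_u(\partial_t\bar u)_*+\bar g_p(\partial_t\bar p)_*=\bar f$ obtained by resolving the left wave. A common nonzero factor in $\bar g_\rho,\bar g_u,\bar g_p,\bar f$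 does not change the system. - 1-rarefaction: $\bar g_\rho=\bar c_*^2$, $\bar g_p=-1$, $\bar g_u=0$. - 1-shock: with $m=1-\bar u_*^2/\bar c_*^2$, $$\bar g_\rho=\bar c_*(\bar u_*-\sigma_L),\qquad \bar g_u=\frac{\bar c_*}{m}\,\bar\rho_*\bar u_*\sigma_L\Bigl(H_1-\frac1{\bar c_*^2}\Bigr),$$ $$\bar g_p=\frac{\bar c_*}{m}\Bigl(\frac{\sigma_L}{\bar c_*^2}-\bar u_*H_1-\frac{\bar u_*^2(\sigma_L-\bar u_* )}{\bar c_*^2}H_1\Bigr).$$ **Right-hand sides.** $d_L,d_R,\bar f$ are given real numbers determined by the initial states, the initial spatial slopes and the associated Riemann solution. They enter only the right-hand side of the linear system. *)

theory Defs
  imports "HOL-Analysis.Analysis"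
begin

text \<open>A gas state is a triple \<open>(\<rho>, u, p)\<close> of density, velocity and pressure. Thus \<open>dist\<close> on states is
  the Euclidean distance of \<open>\<real>\<^sup>3\<close>.\<close>

type_synonym gas_state = "real \<times> real \<times> real"

abbreviation dens :: "gas_state \<Rightarrow> real" where "dens s \<equiv> fst s"
abbreviation vel :: "gas_state \<Rightarrow> real" where "vel s \<equiv> fst (snd s)"
abbreviation pres :: "gas_state \<Rightarrow> real" where "pres s \<equiv> snd (snd s)"

definition admissible :: "gas_state \<Rightarrow> bool" where
  "admissible s \<longleftrightarrow> dens s > 0 \<and> pres s > 0"

definition sound_speed :: "real \<Rightarrow> gas_state \<Rightarrow> real" where
  "sound_speed \<gamma> s = sqrt (\<gamma> * pres s / dens s)"

text \<open>The outtake function is considered for \<open>t \<ge> t0\<close> only, so derivatives are one-sided at \<open>t0\<close>.\<close>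

definition outtake_function :: "real \<Rightarrow> (real \<Rightarrow> real) \<Rightarrow> (real \<Rightarrow> real) \<Rightarrow> bool" where
  "outtake_function t0 \<E> \<E>' \<longleftrightarrow>
     (\<forall>t\<ge>t0. \<E> t \<ge> 0 \<and> (\<E> has_real_derivative \<E>' t) (at t within {t0..}))"

definition mu2 :: "real \<Rightarrow> real" where
  "mu2 \<gamma> = (\<gamma> - 1) / (\<gamma> + 1)"

definition Phi :: "real \<Rightarrow> real \<Rightarrow> real \<Rightarrow> real \<Rightarrow> real" where
  "Phi \<gamma> p p' \<rho>' = (p - p') * sqrt ((1 - mu2 \<gamma>) / (\<rho>' * (p + mu2 \<gamma> * p')))"

definition Hug :: "real \<Rightarrow> real \<Rightarrow> real \<Rightarrow> real \<Rightarrow> real" where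
  "Hug \<gamma> p p' \<rho>' = \<rho>' * ((p + mu2 \<gamma> * p') / (p' + mu2 \<gamma> * p))"

text \<open>In functions of two states, \<open>A\<close> is the state ahead of the wave (outer state)
  and \<open>S\<close> the state behind it (star state).\<close>

definition Phi1 :: "real \<Rightarrow> gas_state \<Rightarrow> gas_state \<Rightarrow> real" where
  "Phi1 \<gamma> A S = deriv (\<lambda>p. Phi \<gamma> p (pres A) (dens A)) (pres S)"

definition Hug1 :: "real \<Rightarrow> gas_state \<Rightarrow> gas_state \<Rightarrow> real" where
  "Hug1 \<gamma> A S = deriv (\<lambda>p. Hug \<gamma> p (pres A) (dens A)) (pres S)"

definition is_shock :: "gas_state \<Rightarrow> gas_state \<Rightarrow> bool" where
  "is_shock A S \<longleftrightarrow> pres S > pres A"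

definition is_rarefaction :: "gas_state \<Rightarrow> gas_state \<Rightarrow> bool" where
  "is_rarefaction A S \<longleftrightarrow> pres S \<le> pres A"

definition shock_speed :: "gas_state \<Rightarrow> gas_state \<Rightarrow> real" where
  "shock_speed A S = (dens S * vel S - dens A * vel A) / (dens S - dens A)"

definition one_wave :: "real \<Rightarrow> gas_state \<Rightarrow> gas_state \<Rightarrow> bool" where
  "one_wave \<gamma> A S \<longleftrightarrow>
     (is_shock A S \<longrightarrow>
        vel S = vel A - Phi \<gamma> (pres S) (pres A) (dens A) \<and>
        dens S = Hug \<gamma> (pres S) (pres A) (dens A) \<and>
        shock_speed A S < 0) \<and>
     (is_rarefaction A S \<longrightarrow>
        pres S * dens S powr (-\<gamma>) = pres A * dens A powr (-\<gamma>) \<and>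
        vel S + 2 * sound_speed \<gamma> S / (\<gamma> - 1) = vel A + 2 * sound_speed \<gamma> A / (\<gamma> - 1))"

definition three_wave :: "real \<Rightarrow> gas_state \<Rightarrow> gas_state \<Rightarrow> bool" where
  "three_wave \<gamma> A S \<longleftrightarrow>
     (is_shock A S \<longrightarrow>
        vel S = vel A + Phi \<gamma> (pres S) (pres A) (dens A) \<and>
        dens S = Hug \<gamma> (pres S) (pres A) (dens A) \<and>
        shock_speed A S > 0) \<and>
     (is_rarefaction A S \<longrightarrow>
        pres S * dens S powr (-\<gamma>) = pres A * dens A powr (-\<gamma>) \<and>
        vel S - 2 * sound_speed \<gamma> S / (\<gamma> - 1) = vel A - 2 * sound_speed \<gamma> A / (\<gamma> - 1))"

text \<open>Coupling at the interface between the state \<open>M\<close> at \<open>x = 0-\<close> and the state \<open>N\<close> at \<open>x = 0+\<close>,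
  with outtake value \<open>E\<close>.\<close>

definition coupling :: "real \<Rightarrow> gas_state \<Rightarrow> gas_state \<Rightarrow> bool" where
  "coupling E M N \<longleftrightarrow> pres M = pres N \<and> dens M = dens N \<and> vel M = vel N + E / dens M"

definition subsonic_rightward :: "real \<Rightarrow> gas_state \<Rightarrow> bool" where
  "subsonic_rightward \<gamma> s \<longleftrightarrow> 0 \<le> vel s \<and> vel s < sound_speed \<gamma> s"

text \<open>The states from left to right are \<open>L\<close>, \<open>M = (\<rho>\<^sub>*, u\<^sub>*, p\<^sub>*)\<close> with bars (at \<open>x = 0-\<close>), \<open>N\<close> (at \<open>x = 0+\<close>),
  \<open>S = (\<rho>\<^sub>*\<^sub>R, u\<^sub>*, p\<^sub>*)\<close> (right of the contact discontinuity, which has speed \<open>vel N\<close>), and \<open>R\<close>.\<close>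

definition coupled_riemann_solution ::
  "real \<Rightarrow> real \<Rightarrow> gas_state \<Rightarrow> gas_state \<Rightarrow> gas_state \<Rightarrow> gas_state \<Rightarrow> gas_state \<Rightarrow> bool" where
  "coupled_riemann_solution \<gamma> E L M N S R \<longleftrightarrow>
     admissible L \<and> admissible M \<and> admissible N \<and> admissible S \<and> admissible R \<and>
     one_wave \<gamma> L M \<and>
     coupling E M N \<and>
     vel S = vel N \<and> pres S = pres N \<and>
     three_wave \<gamma> R S \<and>
     subsonic_rightward \<gamma> M \<and> subsonic_rightward \<gamma> N"

definition aL :: "real \<Rightarrow> gas_state \<Rightarrow> gas_state \<Rightarrow> real" where
  "aL \<gamma> L M = (if is_shock L M
     then 1 - dens M * (shock_speed L M - vel M) * Phi1 \<gamma> L M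
     else 1)"

definition bL :: "real \<Rightarrow> gas_state \<Rightarrow> gas_state \<Rightarrow> real" where
  "bL \<gamma> L M = (if is_shock L M
     then - (shock_speed L M - vel M) / (dens M * (sound_speed \<gamma> M)\<^sup>2) + Phi1 \<gamma> L M
     else 1 / (dens M * sound_speed \<gamma> M))"

definition aR :: "real \<Rightarrow> gas_state \<Rightarrow> gas_state \<Rightarrow> real" where
  "aR \<gamma> R S = (if is_shock R S
     then 1 + dens S * (shock_speed R S - vel S) * Phi1 \<gamma> R S
     else 1)"

definition bR :: "real \<Rightarrow> gas_state \<Rightarrow> gas_state \<Rightarrow> real" where
  "bR \<gamma> R S = (if is_shock R S
     then - (shock_speed R S - vel S) / (dens S * (sound_speed \<gamma> S)\<^sup>2) - Phi1 \<gamma> R S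
     else - 1 / (dens S * sound_speed \<gamma> S))"

definition hL :: "real \<Rightarrow> gas_state \<Rightarrow> gas_state \<Rightarrow> real" where
  "hL \<gamma> L M = aL \<gamma> L M - dens M * vel M * bL \<gamma> L M"

definition kL :: "real \<Rightarrow> gas_state \<Rightarrow> gas_state \<Rightarrow> real" where
  "kL \<gamma> L M = bL \<gamma> L M - vel M / (dens M * (sound_speed \<gamma> M)\<^sup>2) * aL \<gamma> L M"

definition hR :: "real \<Rightarrow> gas_state \<Rightarrow> gas_state \<Rightarrow> real" where
  "hR \<gamma> R S = aR \<gamma> R S - dens S * vel S * bR \<gamma> R S"

definition kR :: "real \<Rightarrow> gas_state \<Rightarrow> gas_state \<Rightarrow> real" where
  "kR \<gamma> R S = bR \<gamma> R S - vel S / (dens S * (sound_speed \<gamma> S)\<^sup>2) * aR \<gamma> R S"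

text \<open>\<open>q\<^sub>L = qcoef \<gamma> M d\<^sub>L\<close> and \<open>q\<^sub>R = qcoef \<gamma> S d\<^sub>R\<close>.\<close>

definition qcoef :: "real \<Rightarrow> gas_state \<Rightarrow> real \<Rightarrow> real" where
  "qcoef \<gamma> s d = (1 - (vel s)\<^sup>2 / (sound_speed \<gamma> s)\<^sup>2) * d"

definition g_rho :: "real \<Rightarrow> gas_state \<Rightarrow> gas_state \<Rightarrow> real" where
  "g_rho \<gamma> L M = (let c = sound_speed \<gamma> M in
     if is_shock L M then c * (vel M - shock_speed L M) else c\<^sup>2)"

definition g_u :: "real \<Rightarrow> gas_state \<Rightarrow> gas_state \<Rightarrow> real" where
  "g_u \<gamma> L M = (let c = sound_speed \<gamma> M; u = vel M; \<sigma> = shock_speed L M; m = 1 - u\<^sup>2 / c\<^sup>2 in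
     if is_shock L M then c / m * dens M * u * \<sigma> * (Hug1 \<gamma> L M - 1 / c\<^sup>2) else 0)"

definition g_p :: "real \<Rightarrow> gas_state \<Rightarrow> gas_state \<Rightarrow> real" where
  "g_p \<gamma> L M = (let c = sound_speed \<gamma> M; u = vel M; \<sigma> = shock_speed L M; m = 1 - u\<^sup>2 / c\<^sup>2 in
     if is_shock L M
     then c / m * (\<sigma> / c\<^sup>2 - u * Hug1 \<gamma> L M - u\<^sup>2 * (\<sigma> - u) / c\<^sup>2 * Hug1 \<gamma> L M)
     else - 1)"

text \<open>The linear system for the time derivatives \<open>X\<close>, \<open>Y\<close>, \<open>Z\<close> of the velocity at \<open>x = 0-\<close>, the velocity
  at \<open>x = 0+\<close>, and the pressure at the interface; \<open>E\<close> and \<open>E'\<close> are the values of the outtake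
  function and of its derivative at the initial time.\<close>

fun grp_system ::
  "real \<Rightarrow> real \<Rightarrow> real \<Rightarrow> gas_state \<Rightarrow> gas_state \<Rightarrow> gas_state \<Rightarrow> gas_state \<Rightarrow>
   real \<Rightarrow> real \<Rightarrow> real \<Rightarrow> real \<times> real \<times> real \<Rightarrow> bool" where
  "grp_system \<gamma> E E' L M S R d\<^sub>L d\<^sub>R f (X, Y, Z) \<longleftrightarrow>
     hL \<gamma> L M * X + kL \<gamma> L M * Z = qcoef \<gamma> M d\<^sub>L \<and>
     hR \<gamma> R S * Y + kR \<gamma> R S * Z = qcoef \<gamma> S d\<^sub>R \<and>
     (1 - E / (dens M)\<^sup>2 * (g_u \<gamma> L M / g_rho \<gamma> L M)) * X - Y
        - E / (dens M)\<^sup>2 * (g_p \<gamma> L M / g_rho \<gamma> L M) * Z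
      = E' / dens M - E / (dens M)\<^sup>2 * (f / g_rho \<gamma> L M)"

end

(* The system is uniquely solvable once h_L > 0, h_R > 0 > k_R and
   k_L (1 - E/rho^2 g_u/g_rho) + h_L E/rho^2 g_p/g_rho > 0, as its determinant is then negative.
   For a 1-rarefaction the last expression is h_L (c - E/rho) / (rho c^2), where
   E/rho <= u < c by the coupling condition. For a 1-shock everything is expressed through
   M = u/c, the relative Mach number s = (u - sigma)/c, phi = rho c Phi_1, eta = c^2 H_1 - 1 and
   e = E/(rho c); the Hugoniot relations and sigma < 0 give e <= M < s < 1, phi >= s and eta <= 0,
   and these imply positivity for shocks of any strength. *)
theory Submission
  imports Defs
begin

section \<open>Linear algebra of the coupled system\<close>

text \<open>The first two equations give \<open>X\<close> and \<open>Y\<close> in terms of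
  \<open>Z\<close>. Inserting them into the third and multiplying by \<open>h1 * h2\<close> leaves
  one equation \<open>D * Z = ...\<close>, where the sign conditions make \<open>D\<close>
  negative.\<close>

lemma three_by_three_unique:
  fixes h1 k1 h2 k2 A B q1 q2 r :: real
  assumes "h1 > 0" "h2 > 0" "k2 < 0" "k1 * A + h1 * B > 0"
  shows "\<exists>!(X, Y, Z). h1 * X + k1 * Z = q1 \<and> h2 * Y + k2 * Z = q2 \<and> A * X - Y - B * Z = r"
proof -
  define D where "D = h1 * k2 - h2 * (k1 * A + h1 * B)"
  have "h1 * k2 < 0" "h2 * (k1 * A + h1 * B) > 0"
    using assms by (simp_all add: mult_pos_neg)
  then have D: "D \<noteq> 0" unfolding D_def by linarith
  define Z0 where "Z0 = (h1 * h2 * r - A * h2 * q1 + h1 * q2) / D"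
  have Z0: "D * Z0 = h1 * h2 * r - A * h2 * q1 + h1 * q2"
    using D by (simp add: Z0_def)
  have iff: "(h1 * X + k1 * Z = q1 \<and> h2 * Y + k2 * Z = q2 \<and> A * X - Y - B * Z = r) \<longleftrightarrow>
      (X = (q1 - k1 * Z0) / h1 \<and> Y = (q2 - k2 * Z0) / h2 \<and> Z = Z0)" for X Y Z
  proof
    assume *: "h1 * X + k1 * Z = q1 \<and> h2 * Y + k2 * Z = q2 \<and> A * X - Y - B * Z = r"
    then have q: "q1 = h1 * X + k1 * Z" "q2 = h2 * Y + k2 * Z" "r = A * X - Y - B * Z" by auto
    have "D * Z = h1 * h2 * r - A * h2 * q1 + h1 * q2"
      unfolding D_def q by (simp add: algebra_simps)
    then have "Z = Z0" using Z0 D by (metis mult_left_cancel)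
    then show "X = (q1 - k1 * Z0) / h1 \<and> Y = (q2 - k2 * Z0) / h2 \<and> Z = Z0"
      using * assms by (auto simp: field_simps)
  next
    assume *: "X = (q1 - k1 * Z0) / h1 \<and> Y = (q2 - k2 * Z0) / h2 \<and> Z = Z0"
    then have X: "h1 * X = q1 - k1 * Z" and Y: "h2 * Y = q2 - k2 * Z"
      using assms by auto
    \<comment> \<open>The third equation is checked after multiplication by \<open>h1 * h2\<close>,
      so that only the known products \<open>h1 * X\<close> and \<open>h2 * Y\<close> occur.\<close>
    have "h1 * h2 * (A * X - Y - B * Z) = A * h2 * (h1 * X) - h1 * (h2 * Y) - h1 * h2 * B * Z"
      by algebra
    also have "\<dots> = h1 * h2 * r"
      unfolding X Y using Z0 * unfolding D_def by algebra
    finally have "A * X - Y - B * Z = r" using assms by simp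
    with X Y show "h1 * X + k1 * Z = q1 \<and> h2 * Y + k2 * Z = q2 \<and> A * X - Y - B * Z = r"
      by simp
  qed
  show ?thesis unfolding iff by auto
qed

lemma grp_system_unique:
  assumes "hL \<gamma> L M > 0" "hR \<gamma> R S > 0" "kR \<gamma> R S < 0"
    and "kL \<gamma> L M * (1 - E / (dens M)\<^sup>2 * (g_u \<gamma> L M / g_rho \<gamma> L M))
      + hL \<gamma> L M * (E / (dens M)\<^sup>2 * (g_p \<gamma> L M / g_rho \<gamma> L M)) > 0"
  shows "\<exists>!W. grp_system \<gamma> E E' L M S R dl dr f W"
proof -
  \<comment> \<open>\<open>grp_system\<close> unfolds only on explicit triples; the case abstraction
    brings it into the form behind \<open>\<exists>!(X, Y, Z)\<close>.\<close>
  have "grp_system \<gamma> E E' L M S R dl dr f = (\<lambda>(X, Y, Z).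
     hL \<gamma> L M * X + kL \<gamma> L M * Z = qcoef \<gamma> M dl \<and>
     hR \<gamma> R S * Y + kR \<gamma> R S * Z = qcoef \<gamma> S dr \<and>
     (1 - E / (dens M)\<^sup>2 * (g_u \<gamma> L M / g_rho \<gamma> L M)) * X - Y
        - E / (dens M)\<^sup>2 * (g_p \<gamma> L M / g_rho \<gamma> L M) * Z
      = E' / dens M - E / (dens M)\<^sup>2 * (f / g_rho \<gamma> L M))"
    by (rule ext) auto
  then show ?thesis using three_by_three_unique[OF assms] by simp
qed

section \<open>Sound speed, derivatives of the wave curves, and shock estimates\<close>

lemma sound_speed_pos: "\<gamma> > 1 \<Longrightarrow> admissible s \<Longrightarrow> sound_speed \<gamma> s > 0"
  by (simp add: sound_speed_def admissible_def)

lemma sound_speed_sq: "\<gamma> > 1 \<Longrightarrow> admissible s \<Longrightarrow> (sound_speed \<gamma> s)\<^sup>2 = \<gamma> * pres s / dens s"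
  by (simp add: sound_speed_def admissible_def)

text \<open>The third fact eliminates \<gamma> in favour of \<open>mu2 \<gamma>\<close>, which turns
  the shock estimates into polynomial inequalities in \<open>mu2 \<gamma>\<close> and the two
  pressures.\<close>

lemma mu2_bounds:
  assumes "\<gamma> > 1"
  shows "0 < mu2 \<gamma>" "mu2 \<gamma> < 1" "\<gamma> = (1 + mu2 \<gamma>) / (1 - mu2 \<gamma>)"
proof -
  have "1 - mu2 \<gamma> = 2 / (\<gamma> + 1)" "1 + mu2 \<gamma> = 2 * \<gamma> / (\<gamma> + 1)"
    using assms by (simp_all add: mu2_def field_simps)
  then show "0 < mu2 \<gamma>" "mu2 \<gamma> < 1" "\<gamma> = (1 + mu2 \<gamma>) / (1 - mu2 \<gamma>)"
    using assms by (simp_all add: mu2_def field_simps)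
qed

text \<open>The square root is kept as a separate factor because it also occurs in
  \<open>Phi\<close>, hence in the relative gas speed behind a shock, and cancels when the two are
  compared.\<close>

lemma Phi_deriv:
  assumes "\<gamma> > 1" "p > 0" "p' > 0" "\<rho>' > 0"
  shows "deriv (\<lambda>p. Phi \<gamma> p p' \<rho>') p =
    sqrt ((1 - mu2 \<gamma>) / (\<rho>' * (p + mu2 \<gamma> * p'))) *
      ((p + (1 + 2 * mu2 \<gamma>) * p') / (2 * (p + mu2 \<gamma> * p')))"
proof (rule DERIV_imp_deriv)
  define m where "m = mu2 \<gamma>"
  define b where "b = p + m * p'"
  define w where "w = (1 - m) / (\<rho>' * b)"
  have m: "0 < m" "m < 1" using mu2_bounds[OF assms(1)] by (simp_all add: m_def)
  have b: "b > 0" using assms m by (simp add: b_def add_pos_pos)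
  have w: "w > 0" using assms m b by (simp add: w_def)
  have "((\<lambda>p. \<rho>' * (p + m * p')) has_real_derivative \<rho>') (at p)"
    by (auto intro!: derivative_eq_intros)
  from DERIV_divide[OF DERIV_const[of "1 - m"] this]
  have "((\<lambda>p. (1 - m) / (\<rho>' * (p + m * p'))) has_real_derivative
      (0 * (\<rho>' * b) - (1 - m) * \<rho>') / (\<rho>' * b * (\<rho>' * b))) (at p)"
    using assms b by (simp add: b_def)
  also have "(0 * (\<rho>' * b) - (1 - m) * \<rho>') / (\<rho>' * b * (\<rho>' * b)) = - w / b"
    using assms b by (simp add: w_def)
  finally have inner: "((\<lambda>p. (1 - m) / (\<rho>' * (p + m * p'))) has_real_derivative - w / b) (at p)" .
  have "((\<lambda>p. sqrt ((1 - m) / (\<rho>' * (p + m * p')))) has_real_derivative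
      - w / b * (inverse (sqrt w) / 2)) (at p)"
    using DERIV_chain2[OF DERIV_real_sqrt inner] w
    by (simp add: w_def b_def mult.commute)
  also have "- w / b * (inverse (sqrt w) / 2) = - sqrt w / (2 * b)"
    using w b real_sqrt_pow2[of w] by (simp add: field_simps power2_eq_square)
  finally have "((\<lambda>p. (p - p') * sqrt ((1 - m) / (\<rho>' * (p + m * p')))) has_real_derivative
      (1 - 0) * sqrt w + (- sqrt w / (2 * b)) * (p - p')) (at p)"
    unfolding w_def b_def by (intro DERIV_mult DERIV_diff DERIV_ident DERIV_const)
  also have "(1 - 0) * sqrt w + (- sqrt w / (2 * b)) * (p - p')
      = sqrt w * ((p + (1 + 2 * m) * p') / (2 * b))"
    using b by (simp add: b_def field_simps)
  finally show "((\<lambda>p. Phi \<gamma> p p' \<rho>') has_real_derivative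
      sqrt ((1 - mu2 \<gamma>) / (\<rho>' * (p + mu2 \<gamma> * p'))) *
      ((p + (1 + 2 * mu2 \<gamma>) * p') / (2 * (p + mu2 \<gamma> * p')))) (at p)"
    by (simp add: Phi_def w_def b_def m_def)
qed

lemma Hug_deriv:
  assumes "\<gamma> > 1" "p > 0" "p' > 0"
  shows "deriv (\<lambda>p. Hug \<gamma> p p' \<rho>') p = \<rho>' * p' * (1 - (mu2 \<gamma>)\<^sup>2) / (p' + mu2 \<gamma> * p)\<^sup>2"
proof (rule DERIV_imp_deriv)
  have "p' + mu2 \<gamma> * p > 0" using assms mu2_bounds[OF assms(1)] by (simp add: add_pos_pos)
  then show "((\<lambda>p. Hug \<gamma> p p' \<rho>') has_real_derivative
      \<rho>' * p' * (1 - (mu2 \<gamma>)\<^sup>2) / (p' + mu2 \<gamma> * p)\<^sup>2) (at p)"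
    unfolding Hug_def
    by (auto intro!: derivative_eq_intros simp: field_simps power2_eq_square)
qed

text \<open>\<open>v\<close> is the gas speed behind the shock relative to the shock front. Comparing
  \<open>Phi1\<close> with \<open>v\<close>, rather than with the isentropic slope \<open>1 / (\<rho> c)\<close>, gives an
  inequality valid for all shock strengths and all \<open>\<gamma>\<close>.\<close>

lemma shock_relations:
  assumes \<gamma>: "\<gamma> > 1" and A: "admissible A" and S: "admissible S" and shock: "is_shock A S"
    and H: "dens S = Hug \<gamma> (pres S) (pres A) (dens A)"
  defines "v \<equiv> dens A * Phi \<gamma> (pres S) (pres A) (dens A) / (dens S - dens A)"
  shows "dens A < dens S" "0 < v" "v < sound_speed \<gamma> S"
    "v \<le> dens S * (sound_speed \<gamma> S)\<^sup>2 * Phi1 \<gamma> A S"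
    "(sound_speed \<gamma> S)\<^sup>2 * Hug1 \<gamma> A S \<le> 1"
proof -
  define m where "m = mu2 \<gamma>"
  define p where "p = pres S"
  define p' where "p' = pres A"
  define \<rho>' where "\<rho>' = dens A"
  define r where "r = sqrt ((1 - m) / (\<rho>' * (p + m * p')))"
  have m: "0 < m" "m < 1" and \<gamma>m: "\<gamma> = (1 + m) / (1 - m)"
    using mu2_bounds[OF \<gamma>] by (simp_all add: m_def)
  have pos: "p > 0" "p' > 0" "\<rho>' > 0" "p > p'" "dens S > 0"
    using A S shock by (auto simp: admissible_def is_shock_def p_def p'_def \<rho>'_def)
  have b: "p + m * p' > 0" and d: "p' + m * p > 0" using pos m by (simp_all add: add_pos_pos)
  have r: "r > 0" and r2: "r\<^sup>2 = (1 - m) / (\<rho>' * (p + m * p'))"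
    using pos m b by (simp_all add: r_def)
  have \<rho>: "dens S = \<rho>' * ((p + m * p') / (p' + m * p))"
    using H by (simp add: Hug_def m_def p_def p'_def \<rho>'_def)
  \<comment> \<open>The density jump carries the factor \<open>p - p'\<close>, which cancels the one
    in \<open>Phi\<close> and makes \<open>v\<close> a multiple of \<open>r\<close>.\<close>
  have diff: "dens S - \<rho>' = \<rho>' * ((1 - m) * (p - p') / (p' + m * p))"
    using d by (simp add: \<rho> field_simps)
  then have "dens S - \<rho>' > 0" using pos m d by simp
  then show "dens A < dens S" by (simp add: \<rho>'_def)
  have v: "v = (p' + m * p) * r / (1 - m)"
  proof -
    have "v = \<rho>' * ((p - p') * r) / (dens S - \<rho>')"
      by (simp add: v_def Phi_def r_def m_def p_def p'_def \<rho>'_def)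
    also have "\<dots> = (p' + m * p) * r / (1 - m)"
      unfolding diff using pos m by simp
    finally show ?thesis .
  qed
  then show v0: "0 < v" using r m d by simp
  have c2: "(sound_speed \<gamma> S)\<^sup>2 = (1 + m) * p * (p' + m * p) / ((1 - m) * \<rho>' * (p + m * p'))"
    using sound_speed_sq[OF \<gamma> S] \<rho> \<gamma>m by (simp add: p_def)
  have \<rho>c2: "dens S * (sound_speed \<gamma> S)\<^sup>2 = (1 + m) / (1 - m) * p"
    using sound_speed_sq[OF \<gamma> S] pos \<gamma>m by (simp add: p_def)
  have "v\<^sup>2 = (p' + m * p) * (p' + m * p) / ((1 - m) * \<rho>' * (p + m * p'))"
  proof -
    have "v\<^sup>2 = (p' + m * p)\<^sup>2 * r\<^sup>2 / (1 - m)\<^sup>2"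
      by (simp add: v power_mult_distrib power_divide)
    also have "\<dots> = (p' + m * p) * (p' + m * p) / ((1 - m) * \<rho>' * (p + m * p'))"
      unfolding r2 using m by (simp add: power2_eq_square)
    finally show ?thesis .
  qed
  \<comment> \<open>Over the common denominator this is \<open>p' + m * p < (1 + m) * p\<close>,
    that is \<open>p' < p\<close>.\<close>
  also have "\<dots> < (sound_speed \<gamma> S)\<^sup>2"
    unfolding c2 using pos m b d
    by (intro divide_strict_right_mono mult_strict_right_mono mult_pos_pos)
      (auto simp: algebra_simps)
  finally show "v < sound_speed \<gamma> S"
    using sound_speed_pos[OF \<gamma> S] by (simp add: power_less_imp_less_base)
  have \<Phi>: "Phi1 \<gamma> A S = r * ((p + (1 + 2 * m) * p') / (2 * (p + m * p')))"
    using Phi_deriv[OF \<gamma> pos(1-3)] unfolding Phi1_def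
    by (simp add: r_def m_def p_def p'_def \<rho>'_def)
  \<comment> \<open>Without the common factor \<open>r / (1 - m)\<close>, the bound on
    \<open>v\<close> is a quadratic inequality in the pressures with equality at
    \<open>p = p'\<close>, so \<open>p - p'\<close> splits off.\<close>
  have "0 \<le> (p - p') * ((1 - m) * p + 2 * m * p')"
    using pos m by (intro mult_nonneg_nonneg add_nonneg_nonneg) auto
  then have "(p' + m * p) * (2 * (p + m * p')) \<le> (1 + m) * p * (p + (1 + 2 * m) * p')"
    by (simp add: algebra_simps power2_eq_square)
  then have "p' + m * p \<le> (1 + m) * p * (p + (1 + 2 * m) * p') / (2 * (p + m * p'))"
    using b by (subst pos_le_divide_eq) auto
  then have "r / (1 - m) * (p' + m * p) \<le>
      r / (1 - m) * ((1 + m) * p * (p + (1 + 2 * m) * p') / (2 * (p + m * p')))"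
    using r m by (intro mult_left_mono) auto
  then show "v \<le> dens S * (sound_speed \<gamma> S)\<^sup>2 * Phi1 \<gamma> A S"
    unfolding v \<rho>c2 \<Phi> by (simp add: mult_ac)
  have H1: "Hug1 \<gamma> A S = \<rho>' * p' * (1 - m\<^sup>2) / (p' + m * p)\<^sup>2"
    using Hug_deriv[OF \<gamma> pos(1,2)] unfolding Hug1_def
    by (simp add: m_def p_def p'_def \<rho>'_def)
  have "(sound_speed \<gamma> S)\<^sup>2 * Hug1 \<gamma> A S = (1 + m)\<^sup>2 * p * p' / ((p + m * p') * (p' + m * p))"
    unfolding c2 H1 using pos m b d
    by (simp add: divide_simps) (simp add: power2_eq_square algebra_simps)
  also have "\<dots> \<le> 1"
  proof -
    \<comment> \<open>This square is exactly the denominator minus the numerator.\<close>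
    have "0 \<le> m * (p - p')\<^sup>2" using m by simp
    then have "(1 + m)\<^sup>2 * p * p' \<le> (p + m * p') * (p' + m * p)"
      by (simp add: algebra_simps power2_eq_square)
    then show ?thesis using b d by (simp add: divide_le_eq_1)
  qed
  finally show "(sound_speed \<gamma> S)\<^sup>2 * Hug1 \<gamma> A S \<le> 1" .
qed

section \<open>Sign conditions for the right-going and the left-going wave\<close>

text \<open>For either type of wave \<open>aR\<close> is positive and \<open>bR\<close> negative. As
  the gas moves to the right, the velocity terms in \<open>hR\<close> and \<open>kR\<close> only
  reinforce these signs.\<close>

lemma three_wave_coefficients:
  assumes \<gamma>: "\<gamma> > 1" and R: "admissible R" and S: "admissible S"
    and wave: "three_wave \<gamma> R S" and u: "vel S \<ge> 0"
  shows "hR \<gamma> R S > 0" "kR \<gamma> R S < 0"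
proof -
  have c: "sound_speed \<gamma> S > 0" and \<rho>: "dens S > 0"
    using sound_speed_pos[OF \<gamma> S] S by (auto simp: admissible_def)
  have "aR \<gamma> R S > 0 \<and> bR \<gamma> R S < 0"
  proof (cases "is_shock R S")
    case True
    with wave have H: "dens S = Hug \<gamma> (pres S) (pres R) (dens R)"
      and \<Phi>: "vel S = vel R + Phi \<gamma> (pres S) (pres R) (dens R)"
      by (auto simp: three_wave_def)
    define v where "v = dens R * Phi \<gamma> (pres S) (pres R) (dens R) / (dens S - dens R)"
    note * = shock_relations[OF \<gamma> R S True H, folded v_def]
    \<comment> \<open>Conservation of mass across the shock: the relative speed is the density ahead
      times the velocity jump, divided by the density jump.\<close>
    have v: "shock_speed R S - vel S = v"
      using \<open>dens R < dens S\<close> by (simp add: shock_speed_def v_def \<Phi> field_simps)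
    \<comment> \<open>Positivity of \<open>Phi1\<close> is read off from its lower bound by
      \<open>v\<close>.\<close>
    have "0 < dens S * (sound_speed \<gamma> S)\<^sup>2 * Phi1 \<gamma> R S" using * by linarith
    then have "Phi1 \<gamma> R S > 0" by (rule zero_less_mult_pos) (use c \<rho> in simp)
    then have "dens S * v * Phi1 \<gamma> R S > 0" "v / (dens S * (sound_speed \<gamma> S)\<^sup>2) > 0"
      using * c \<rho> by simp_all
    then show ?thesis using \<open>Phi1 \<gamma> R S > 0\<close> True by (simp add: aR_def bR_def v)
  next
    case False
    then show ?thesis using c \<rho> by (simp add: aR_def bR_def)
  qed
  then have a: "aR \<gamma> R S > 0" and b: "bR \<gamma> R S < 0" by auto
  have "dens S * vel S * bR \<gamma> R S \<le> 0" using \<rho> u b by (simp add: mult_nonneg_nonpos)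
  then show "hR \<gamma> R S > 0" using a by (simp add: hR_def)
  have "0 \<le> vel S / (dens S * (sound_speed \<gamma> S)\<^sup>2) * aR \<gamma> R S" using c \<rho> u a by simp
  then show "kR \<gamma> R S < 0" using b by (simp add: kR_def)
qed

text \<open>The expression is affine in \<open>e\<close> (its \<open>\<eta>\<close>-terms combine because
  \<open>(s - M)\<^sup>2 - (1 - M s)\<^sup>2 = - (1 - s\<^sup>2) (1 - M\<^sup>2)\<close>), so it suffices to bound it at \<open>e = M\<close>, where
  \<open>\<phi> \<ge> s\<close> leaves at least \<open>2 (s - M) (1 - M s)\<close>.\<close>

lemma shock_determinant_pos:
  fixes M s \<phi> e \<eta> :: real
  assumes "0 \<le> M" "M < s" "s < 1" "s \<le> \<phi>" "0 \<le> e" "e \<le> M" "\<eta> \<le> 0"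
  defines "h \<equiv> (1 - M * s) + \<phi> * (s - M)" and "k \<equiv> (s - M) + \<phi> * (1 - M * s)"
  shows "0 < h"
    "0 < k * (1 + e * M * \<eta> * (s - M) / ((1 - M\<^sup>2) * s))
       - h * (e * (1 + \<eta> * M * (1 - M * s) / ((1 - M\<^sup>2) * s)))"
proof -
  have Ms: "M * s < 1" using assms mult_strict_mono[of M 1 s 1] by auto
  have M2: "M\<^sup>2 < 1" using assms by (simp add: power_less_one_iff abs_square_less_1)
  have s: "s > 0" and \<phi>: "\<phi> > 0" using assms by auto
  have "0 \<le> \<phi> * (s - M)" using assms \<phi> by simp
  then show h: "0 < h" using Ms by (simp add: h_def)
  have "k * (1 + e * M * \<eta> * (s - M) / ((1 - M\<^sup>2) * s))
       - h * (e * (1 + \<eta> * M * (1 - M * s) / ((1 - M\<^sup>2) * s)))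
     = k - e * h + e * M * \<eta> * (k * (s - M) - h * (1 - M * s)) / ((1 - M\<^sup>2) * s)"
    by (simp add: algebra_simps diff_divide_distrib add_divide_distrib)
  also have "k * (s - M) - h * (1 - M * s) = - (1 - s\<^sup>2) * (1 - M\<^sup>2)"
    by (simp add: h_def k_def algebra_simps power2_eq_square)
  also have "e * M * \<eta> * (- (1 - s\<^sup>2) * (1 - M\<^sup>2)) / ((1 - M\<^sup>2) * s) = e * M * (- \<eta>) * (1 - s\<^sup>2) / s"
    using M2 s by (simp add: field_simps)
  also have "k - e * h + e * M * (- \<eta>) * (1 - s\<^sup>2) / s > 0"
  proof -
    have "0 \<le> e * M * (- \<eta>) * (1 - s\<^sup>2) / s"
      using assms s by (intro divide_nonneg_nonneg mult_nonneg_nonneg) (auto simp: power_le_one)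
    moreover have "e * h \<le> M * h" using assms h by (simp add: mult_right_mono)
    moreover have "0 < 2 * ((s - M) * (1 - M * s))" using assms Ms by simp
    \<comment> \<open>The second factor equals \<open>1 - 2 * M * s + M\<^sup>2\<close>, the
      coefficient of \<phi> in \<open>k - M * h\<close>, written so that its sign is
      visible.\<close>
    moreover have "0 \<le> (\<phi> - s) * ((1 - s\<^sup>2) + (s - M)\<^sup>2)"
      using assms s by (intro mult_nonneg_nonneg add_nonneg_nonneg) (auto simp: power_le_one)
    moreover have "k - M * h = 2 * ((s - M) * (1 - M * s)) + (\<phi> - s) * ((1 - s\<^sup>2) + (s - M)\<^sup>2)"
      by (simp add: h_def k_def algebra_simps power2_eq_square)
    ultimately show ?thesis by linarith
  qed
  finally show "0 < k * (1 + e * M * \<eta> * (s - M) / ((1 - M\<^sup>2) * s))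
       - h * (e * (1 + \<eta> * M * (1 - M * s) / ((1 - M\<^sup>2) * s)))" .
qed

text \<open>Here \<open>g_u\<close> vanishes, \<open>g_p / g_rho\<close> is
  \<open>- 1 / c\<^sup>2\<close> and \<open>kL\<close> is proportional to \<open>hL\<close>, so
  \<open>hL\<close> factors out of the whole expression.\<close>

lemma one_rarefaction_determinant_pos:
  assumes \<gamma>: "\<gamma> > 1" and M: "admissible M" and u: "subsonic_rightward \<gamma> M"
    and rare: "is_rarefaction L M" and E: "E / dens M \<le> vel M"
  shows "hL \<gamma> L M > 0"
    "kL \<gamma> L M * (1 - E / (dens M)\<^sup>2 * (g_u \<gamma> L M / g_rho \<gamma> L M))
      + hL \<gamma> L M * (E / (dens M)\<^sup>2 * (g_p \<gamma> L M / g_rho \<gamma> L M)) > 0"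
proof -
  define c where "c = sound_speed \<gamma> M"
  have c: "c > 0" and \<rho>: "dens M > 0" and uc: "vel M < c"
    using sound_speed_pos[OF \<gamma> M] M u by (auto simp: admissible_def c_def subsonic_rightward_def)
  have ns: "\<not> is_shock L M" using rare by (simp add: is_shock_def is_rarefaction_def)
  have h: "hL \<gamma> L M = 1 - vel M / c"
    using \<rho> ns by (simp add: hL_def aL_def bL_def c_def)
  show hpos: "hL \<gamma> L M > 0" using c uc by (simp add: h)
  have k: "kL \<gamma> L M = hL \<gamma> L M * (1 / (dens M * c))"
    using \<rho> c ns unfolding h
    by (simp add: kL_def aL_def bL_def field_simps power2_eq_square flip: c_def)
  have "kL \<gamma> L M * (1 - E / (dens M)\<^sup>2 * (g_u \<gamma> L M / g_rho \<gamma> L M))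
      + hL \<gamma> L M * (E / (dens M)\<^sup>2 * (g_p \<gamma> L M / g_rho \<gamma> L M))
      = hL \<gamma> L M * (1 / (dens M * c\<^sup>2) * (c - E / dens M))"
    using \<rho> c ns unfolding k
    by (simp add: g_u_def g_rho_def g_p_def field_simps power2_eq_square flip: c_def)
  also have "\<dots> > 0" using hpos \<rho> c uc E by simp
  finally show "kL \<gamma> L M * (1 - E / (dens M)\<^sup>2 * (g_u \<gamma> L M / g_rho \<gamma> L M))
      + hL \<gamma> L M * (E / (dens M)\<^sup>2 * (g_p \<gamma> L M / g_rho \<gamma> L M)) > 0" .
qed

text \<open>Rescaling by \<rho> and \<open>c\<close> reduces the claim to
  \<open>shock_determinant_pos\<close>: \<open>hL\<close> becomes \<open>h\<close>,
  \<open>kL\<close> becomes \<open>k / (\<rho> * c)\<close>, and the second expression is the one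
  there divided by \<open>\<rho> * c\<close>.\<close>

lemma one_shock_determinant_pos:
  assumes \<gamma>: "\<gamma> > 1" and L: "admissible L" and M: "admissible M"
    and u: "subsonic_rightward \<gamma> M" and shock: "is_shock L M" and wave: "one_wave \<gamma> L M"
    and E: "0 \<le> E" "E / dens M \<le> vel M"
  shows "hL \<gamma> L M > 0"
    "kL \<gamma> L M * (1 - E / (dens M)\<^sup>2 * (g_u \<gamma> L M / g_rho \<gamma> L M))
      + hL \<gamma> L M * (E / (dens M)\<^sup>2 * (g_p \<gamma> L M / g_rho \<gamma> L M)) > 0"
proof -
  from wave shock have H: "dens M = Hug \<gamma> (pres M) (pres L) (dens L)"
    and \<Phi>: "vel M = vel L - Phi \<gamma> (pres M) (pres L) (dens L)" and \<sigma>: "shock_speed L M < 0"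
    by (auto simp: one_wave_def)
  define v where "v = dens L * Phi \<gamma> (pres M) (pres L) (dens L) / (dens M - dens L)"
  note rel = shock_relations[OF \<gamma> L M shock H, folded v_def]
  \<comment> \<open>Conservation of mass again, with the sign reversed because a 1-shock moves to
    the left relative to the gas behind it.\<close>
  have v: "shock_speed L M = vel M - v"
    using rel(1) by (simp add: shock_speed_def v_def \<Phi> field_simps)
  define c where "c = sound_speed \<gamma> M"
  define \<rho> where "\<rho> = dens M"
  have c: "c > 0" and \<rho>: "\<rho> > 0" and uc: "0 \<le> vel M" "vel M < c"
    using sound_speed_pos[OF \<gamma> M] M u
    by (auto simp: admissible_def c_def \<rho>_def subsonic_rightward_def)
  define U where "U = vel M / c"
  define s where "s = v / c"
  define \<phi> where "\<phi> = \<rho> * c * Phi1 \<gamma> L M"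
  define \<eta> where "\<eta> = c\<^sup>2 * Hug1 \<gamma> L M - 1"
  define e where "e = E / (\<rho> * c)"
  \<comment> \<open>The rescalings solved for the physical quantities; unfolding these equations
    leaves only \<rho>, \<open>c\<close> and dimensionless variables.\<close>
  have sub: "vel M = U * c" "v = s * c" "Phi1 \<gamma> L M = \<phi> / (\<rho> * c)"
    "Hug1 \<gamma> L M = (1 + \<eta>) / c\<^sup>2" "E = e * (\<rho> * c)" "shock_speed L M = (U - s) * c"
    using c \<rho> by (simp_all add: U_def s_def \<phi>_def \<eta>_def e_def v left_diff_distrib)
  \<comment> \<open>A negative shock speed means \<open>vel M < v\<close>, hence
    \<open>U < s\<close>; and \<open>v < c\<close> gives \<open>s < 1\<close>.\<close>
  have "U < s" "0 \<le> U" "s < 1"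
    using \<sigma> v rel(3) c uc by (simp_all add: U_def s_def divide_strict_right_mono flip: c_def)
  moreover have "s \<le> \<phi>"
    using rel(4) c by (simp add: s_def \<phi>_def pos_divide_le_eq power2_eq_square mult_ac flip: c_def \<rho>_def)
  moreover have "0 \<le> e" using E c \<rho> by (simp add: e_def)
  moreover have "e \<le> U"
  proof -
    have "e = (E / \<rho>) / c" by (simp add: e_def)
    also have "\<dots> \<le> U"
      using E(2) c unfolding U_def \<rho>_def by (intro divide_right_mono) auto
    finally show ?thesis .
  qed
  moreover have "\<eta> \<le> 0" using rel(5) by (simp add: \<eta>_def c_def)
  ultimately have hyps: "0 \<le> U" "U < s" "s < 1" "s \<le> \<phi>" "0 \<le> e" "e \<le> U" "\<eta> \<le> 0" by auto
  note pos = shock_determinant_pos[OF hyps]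
  have s: "s > 0" using hyps by linarith
  have U2: "1 - U\<^sup>2 > 0" using hyps by (simp add: abs_square_less_1)
  have a: "aL \<gamma> L M = 1 + s * \<phi>" and b: "bL \<gamma> L M = (s + \<phi>) / (\<rho> * c)"
    using c \<rho> shock unfolding aL_def bL_def sub
    by (simp_all add: field_simps power2_eq_square flip: c_def \<rho>_def)
  have h: "hL \<gamma> L M = (1 - U * s) + \<phi> * (s - U)"
    using c \<rho> unfolding hL_def a b sub
    by (simp add: field_simps flip: c_def \<rho>_def)
  have k: "kL \<gamma> L M = ((s - U) + \<phi> * (1 - U * s)) / (\<rho> * c)"
    using c \<rho> unfolding kL_def a b sub
    by (simp add: field_simps power2_eq_square flip: c_def \<rho>_def)
  show "hL \<gamma> L M > 0" using pos(1) by (simp add: h)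
  have m: "1 - (U * c)\<^sup>2 / c\<^sup>2 = 1 - U\<^sup>2" using c by (simp add: power_mult_distrib)
  have g\<rho>: "g_rho \<gamma> L M = c\<^sup>2 * s"
    using shock unfolding g_rho_def Let_def sub
    by (simp add: algebra_simps power2_eq_square flip: c_def \<rho>_def)
  have gu: "g_u \<gamma> L M = \<rho> * c * U * (U - s) * \<eta> / (1 - U\<^sup>2)"
    using c shock unfolding g_u_def Let_def sub c_def[symmetric] \<rho>_def[symmetric] m
    by (simp add: power2_eq_square flip: diff_divide_distrib)
  \<comment> \<open>The terms free of \<eta> in the numerator combine to
    \<open>- s * (1 - U\<^sup>2)\<close>, which cancels the denominator.\<close>
  have gp: "g_p \<gamma> L M = - (s + \<eta> * U * (1 - U * s) / (1 - U\<^sup>2))"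
  proof -
    have "g_p \<gamma> L M = ((U - s) - U * (1 + \<eta>) + U\<^sup>2 * s * (1 + \<eta>)) / (1 - U\<^sup>2)"
      using c shock unfolding g_p_def Let_def sub c_def[symmetric] \<rho>_def[symmetric] m
      by (simp add: divide_simps) (simp add: algebra_simps power2_eq_square)
    also have "\<dots> = - (s + \<eta> * U * (1 - U * s) / (1 - U\<^sup>2))"
      using U2 by (simp add: divide_simps) (simp add: algebra_simps power2_eq_square)
    finally show ?thesis .
  qed
  have gu': "1 - E / (dens M)\<^sup>2 * (g_u \<gamma> L M / g_rho \<gamma> L M)
      = 1 + e * U * \<eta> * (s - U) / ((1 - U\<^sup>2) * s)"
    using c \<rho> s U2 unfolding gu g\<rho> sub \<rho>_def[symmetric]
    by (simp add: divide_simps) (simp add: algebra_simps power2_eq_square)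
  have gp': "E / (dens M)\<^sup>2 * (g_p \<gamma> L M / g_rho \<gamma> L M)
      = - (e * (1 + \<eta> * U * (1 - U * s) / ((1 - U\<^sup>2) * s))) / (\<rho> * c)"
    using c \<rho> s U2 unfolding gp g\<rho> sub \<rho>_def[symmetric]
    by (simp add: divide_simps) (simp add: algebra_simps power2_eq_square)
  have "x / (\<rho> * c) * y + z * (- w / (\<rho> * c)) = (x * y - z * w) / (\<rho> * c)" for x y z w
    by (simp add: diff_divide_distrib)
  then show "kL \<gamma> L M * (1 - E / (dens M)\<^sup>2 * (g_u \<gamma> L M / g_rho \<gamma> L M))
      + hL \<gamma> L M * (E / (dens M)\<^sup>2 * (g_p \<gamma> L M / g_rho \<gamma> L M)) > 0"
    unfolding gu' gp' h k using pos(2) c \<rho> by simp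
qed

section \<open>Combination of both waves\<close>

lemma coupled_riemann_grp_system_unique:
  assumes \<gamma>: "\<gamma> > 1" and E: "E \<ge> 0" and sol: "coupled_riemann_solution \<gamma> E L M N S R"
  shows "\<exists>!W. grp_system \<gamma> E E' L M S R dl dr f W"
proof -
  \<comment> \<open>The last two facts come from \<open>vel N \<ge> 0\<close>: the contact preserves
    velocity, and the coupling gives \<open>vel N = vel M - E / dens M\<close>.\<close>
  have ad: "admissible L" "admissible M" "admissible R" "admissible S"
    and waves: "one_wave \<gamma> L M" "three_wave \<gamma> R S"
    and u: "subsonic_rightward \<gamma> M" and uS: "vel S \<ge> 0" and Eu: "E / dens M \<le> vel M"
    using sol by (auto simp: coupled_riemann_solution_def coupling_def subsonic_rightward_def)
  note right = three_wave_coefficients[OF \<gamma> ad(3,4) waves(2) uS]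
  show ?thesis
  proof (cases "is_shock L M")
    case True
    note left = one_shock_determinant_pos[OF \<gamma> ad(1,2) u True waves(1) E Eu]
    show ?thesis by (rule grp_system_unique[OF left(1) right left(2)])
  next
    case False
    then have "is_rarefaction L M" by (simp add: is_shock_def is_rarefaction_def)
    note left = one_rarefaction_determinant_pos[OF \<gamma> ad(2) u this Eu]
    show ?thesis by (rule grp_system_unique[OF left(1) right left(2)])
  qed
qed

theorem theorem1:
  fixes \<gamma> :: real
  assumes "\<gamma> > 1"
  shows
    "(\<forall>t0 \<E> \<E>' L M N S R d\<^sub>L d\<^sub>R f.
        outtake_function t0 \<E> \<E>' \<and>
        coupled_riemann_solution \<gamma> (\<E> t0) L M N S R \<and>
        is_rarefaction L M \<longrightarrow>
        (\<exists>!W. grp_system \<gamma> (\<E> t0) (\<E>' t0) L M S R d\<^sub>L d\<^sub>R f W)) \<and>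
     (\<forall>L E. admissible L \<and> E \<ge> 0 \<longrightarrow>
        (\<exists>\<epsilon>>0. \<forall>t0 \<E> \<E>' M N S R d\<^sub>L d\<^sub>R f.
           outtake_function t0 \<E> \<E>' \<and> \<E> t0 = E \<and>
           coupled_riemann_solution \<gamma> E L M N S R \<and>
           is_shock L M \<and> dist M L < \<epsilon> \<longrightarrow>
           (\<exists>!W. grp_system \<gamma> E (\<E>' t0) L M S R d\<^sub>L d\<^sub>R f W)))"
proof (intro conjI allI impI)
  fix t0 \<E> \<E>' L M N S R d\<^sub>L d\<^sub>R f
  assume "outtake_function t0 \<E> \<E>' \<and> coupled_riemann_solution \<gamma> (\<E> t0) L M N S R \<and>
    is_rarefaction L M"
  then have "\<E> t0 \<ge> 0" "coupled_riemann_solution \<gamma> (\<E> t0) L M N S R"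
    by (auto simp: outtake_function_def)
  then show "\<exists>!W. grp_system \<gamma> (\<E> t0) (\<E>' t0) L M S R d\<^sub>L d\<^sub>R f W"
    by (rule coupled_riemann_grp_system_unique[OF assms])
next
  fix L :: gas_state and E :: real
  assume "admissible L \<and> E \<ge> 0"
  then show "\<exists>\<epsilon>>0. \<forall>t0 \<E> \<E>' M N S R d\<^sub>L d\<^sub>R f.
           outtake_function t0 \<E> \<E>' \<and> \<E> t0 = E \<and>
           coupled_riemann_solution \<gamma> E L M N S R \<and>
           is_shock L M \<and> dist M L < \<epsilon> \<longrightarrow>
           (\<exists>!W. grp_system \<gamma> E (\<E>' t0) L M S R d\<^sub>L d\<^sub>R f W)"
    \<comment> \<open>Solvability is established for shocks of every strength, so the radius can be
      any positive number; \<open>1\<close> is taken.\<close>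
    using coupled_riemann_grp_system_unique[OF assms] by (intro exI[of _ 1] conjI zero_less_one) blast
qed

end
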